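(* Let $r\ge 2$ and let $\mathcal H=(X,E)$ be a simple $r$-uniform hypergraph with vertex set $X=\{x_1,x_2,\dots,x_n\}$, $n\ge 1$. Then for every positive integer $k$, $$P_{DP}(\mathcal H,k)\le \frac{k^{n}\,(k^{r-1}-1)^{|E|}}{k^{(r-1)|E|}}.$$
   Context: A hypergraph $\mathcal H=(X,E)$ consists of a finite non-empty set $X$ (vertices) and a set $E\subseteq 2^X$ (edges) with $|e|\ge 2$ for every $e\in E$. It is simple if $e_1\not\subseteq e_2$ for any two distinct edges $e_1,e_2$, and $r$-uniform if $|e|=r$ for every $e\in E$. For a positive integer $k$ write $[k]=\{1,\dots,k\}$. A partial map $\varphi:X\rightharpoonup [k]$ is a function from a subset $\mathrm{dom}(\varphi)\subseteq X$ to $[k]$; it is identified with its graph $\{(x,\varphi(x)):x\in\mathrm{dom}(\varphi)\}\subseteq X\times[k]$. A $k$-fold cover of $\mathcal H$ is a set $\mathcal F$ of partial maps $X\rightharpoonup[k]$ such that $\mathrm{dom}(\varphi)\in E$ for every $\varphi\in\mathcal F$, and whenever $\varphi\neq\psi$ in $\mathcal F$ have $\mathrm{dom}(\varphi)=\mathrm{dom}(\psi)$, then $\varphi\cap\psi=\emptyset$ (i.e. $\varphi(x)\ne\psi(x)$ for all $x$ in the common domain). An $\mathcal F$-coloring of $\mathcal H$ is a function $f:X\to[k]$ such that $\varphi\not\subseteq f$ for every $\varphi\in\mathcal F$. $P_{DP}(\mathcal H,\mathcal F)$ denotes the number of $\mathcal F$-colorings, and the DP color function $P_{DP}(\mathcal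 H,k)$ is the minimum of $P_{DP}(\mathcal H,\mathcal F)$ over all $k$-fold covers $\mathcal F$ of $\mathcal H$. *)

theory Defs
  imports Complex_Main
begin

definition hypergraph :: "'a set \<Rightarrow> 'a set set \<Rightarrow> bool" where
  "hypergraph X E \<longleftrightarrow> finite X \<and> X \<noteq> {} \<and> E \<subseteq> Pow X \<and> (\<forall>e\<in>E. card e \<ge> 2)"

definition simple_hypergraph :: "'a set \<Rightarrow> 'a set set \<Rightarrow> bool" where
  "simple_hypergraph X E \<longleftrightarrow>
     hypergraph X E \<and> (\<forall>e1\<in>E. \<forall>e2\<in>E. e1 \<noteq> e2 \<longrightarrow> \<not> e1 \<subseteq> e2)"

definition uniform_hypergraph :: "nat \<Rightarrow> 'a set \<Rightarrow> 'a set set \<Rightarrow> bool" where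
  "uniform_hypergraph r X E \<longleftrightarrow> hypergraph X E \<and> (\<forall>e\<in>E. card e = r)"

text \<open>Partial maps from \<open>X\<close> to \<open>[k]\<close> are maps \<open>'a \<rightharpoonup> nat\<close> with domain inside \<open>X\<close> and range
  inside \<open>{1..k}\<close>.\<close>

definition fold_cover :: "nat \<Rightarrow> 'a set \<Rightarrow> 'a set set \<Rightarrow> ('a \<rightharpoonup> nat) set \<Rightarrow> bool" where
  "fold_cover k X E F \<longleftrightarrow>
     (\<forall>\<phi>\<in>F. dom \<phi> \<subseteq> X \<and> ran \<phi> \<subseteq> {1..k} \<and> dom \<phi> \<in> E) \<and>
     (\<forall>\<phi>\<in>F. \<forall>\<psi>\<in>F. \<phi> \<noteq> \<psi> \<and> dom \<phi> = dom \<psi> \<longrightarrow> Map.graph \<phi> \<inter> Map.graph \<psi> = {})"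

text \<open>A coloring \<open>f : X \<rightarrow> [k]\<close> is a map with domain exactly \<open>X\<close>, so that colorings are counted
  as functions on \<open>X\<close> and \<open>\<phi> \<subseteq>\<^sub>m f\<close> is inclusion of graphs.\<close>

definition cover_colorings :: "nat \<Rightarrow> 'a set \<Rightarrow> ('a \<rightharpoonup> nat) set \<Rightarrow> ('a \<rightharpoonup> nat) set" where
  "cover_colorings k X F =
     {f. dom f = X \<and> ran f \<subseteq> {1..k} \<and> (\<forall>\<phi>\<in>F. \<not> \<phi> \<subseteq>\<^sub>m f)}"

text \<open>The infimum is over a non-empty set of natural numbers, hence a minimum; see
  \<open>dp_color_function_attained\<close> below.\<close>

definition dp_color_function :: "'a set \<Rightarrow> 'a set set \<Rightarrow> nat \<Rightarrow> nat" where
  "dp_color_function X E k = (INF F\<in>{F. fold_cover k X E F}. card (cover_colorings k X F))"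

lemma finite_cover_colorings:
  assumes "finite X"
  shows "finite (cover_colorings k X F)"
  by (rule finite_subset[OF _ finite_set_of_finite_maps[OF assms finite_atLeastAtMost[of 1 k]]])
     (auto simp: cover_colorings_def)

lemma dp_color_function_attained:
  "\<exists>F. fold_cover k X E F \<and> dp_color_function X E k = card (cover_colorings k X F)"
proof -
  let ?N = "(\<lambda>F. card (cover_colorings k X F)) ` {F. fold_cover k X E F}"
  have "fold_cover k X E {}"
    by (simp add: fold_cover_def)
  then have "?N \<noteq> {}"
    by blast
  then have "Inf ?N \<in> ?N"
    by (rule Inf_nat_def1)
  then show ?thesis
    by (auto simp: dp_color_function_def)
qed

lemma dp_color_function_le:
  assumes "fold_cover k X E F"
  shows "dp_color_function X E k \<le> card (cover_colorings k X F)"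
  unfolding dp_color_function_def using assms by (intro cINF_lower) auto

end

theory Submission
  imports Defs "HOL-Library.FuncSet"
begin

text \<open>The edges are treated one after the other. For an edge \<open>e\<close> with a chosen vertex \<open>v\<close>, the
  \<open>k ^ r\<close> maps \<open>e \<rightarrow> [k]\<close> fall into \<open>k ^ (r - 1)\<close> classes according to the differences
  \<open>f x - f v\<close> modulo \<open>k\<close>. Any two distinct maps of one class are disjoint, so each class may be put
  into a cover. By pigeonhole some class forbids at least a fraction \<open>1 / k ^ (r - 1)\<close> of the
  colorings that survived the previous edges.\<close>

definition shift_pattern :: "nat \<Rightarrow> 'a set \<Rightarrow> 'a \<Rightarrow> ('a \<rightharpoonup> nat) \<Rightarrow> 'a \<Rightarrow> int" where
  "shift_pattern k e v f = (\<lambda>x\<in>e - {v}. (int (the (f x)) - int (the (f v))) mod int k)"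

text \<open>Restricting patterns to \<open>e - {v}\<close> drops the entry at \<open>v\<close>,
  which would always be 0. For finite \<open>e\<close> containing \<open>v\<close>, the patterns
  thus lie in a function space of size \<open>k ^ (card e - 1)\<close>, ready for the pigeonhole
  argument.\<close>

lemma shift_pattern_in_PiE:
  assumes "k \<ge> 1"
  shows "shift_pattern k e v f \<in> (e - {v}) \<rightarrow>\<^sub>E {0..<int k}"
  using assms by (auto simp: shift_pattern_def)

lemma shift_pattern_cong:
  assumes "\<And>x. x \<in> e \<Longrightarrow> f x = g x" "v \<in> e"
  shows "shift_pattern k e v f = shift_pattern k e v g"
  using assms by (auto simp: shift_pattern_def fun_eq_iff)

lemma shift_pattern_diff_mod:
  assumes "shift_pattern k e v f = shift_pattern k e v g" "x \<in> e"
  shows "(int (the (f x)) - int (the (f v))) mod int k =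
         (int (the (g x)) - int (the (g v))) mod int k"
proof (cases "x = v")
  case False
  then show ?thesis
    using fun_cong[OF assms(1), of x] assms(2) by (simp add: shift_pattern_def)
qed simp

text \<open>Two colors differ by less than \<open>k\<close> in absolute value, and 0 is the only
  multiple of \<open>k\<close> in that range.\<close>

lemma mod_eq_imp_eq_in_interval:
  fixes a b k :: nat
  assumes "int a mod int k = int b mod int k" "a \<in> {1..k}" "b \<in> {1..k}"
  shows "a = b"
proof -
  have "int k dvd int a - int b"
    using assms(1) by (simp add: mod_eq_dvd_iff)
  moreover have "\<bar>int a - int b\<bar> < int k"
    using assms(2,3) by auto
  ultimately show ?thesis
    using dvd_imp_le_int[of "int a - int b" "int k"] by auto
qed

lemma the_in_if_ran_subset:
  assumes "ran f \<subseteq> A" "x \<in> dom f"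
  shows "the (f x) \<in> A"
  using assms by (auto intro: ranI)

text \<open>Two maps with the same pattern differ by a constant shift modulo \<open>k\<close> on all
  of \<open>e\<close>. Agreement at the single vertex \<open>x\<close> makes this shift zero. Hence
  distinct maps of one class have disjoint graphs, as a cover demands.\<close>

lemma eq_if_shift_pattern_eq:
  assumes pat: "shift_pattern k e v f = shift_pattern k e v g"
    and dom: "dom f = e" "dom g = e"
    and ran: "ran f \<subseteq> {1..k}" "ran g \<subseteq> {1..k}"
    and "v \<in> e" "x \<in> e" "f x = g x"
  shows "f = g"
proof -
  have val: "the (f y) \<in> {1..k}" "the (g y) \<in> {1..k}" if "y \<in> e" for y
    using that dom ran by (blast intro: the_in_if_ran_subset)+
  \<comment> \<open>Subtracting the difference at \<open>x\<close> from the common value at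
    \<open>x\<close> recovers the value at \<open>v\<close>.\<close>
  have "(int (the (f x)) - (int (the (f x)) - int (the (f v)))) mod int k =
        (int (the (g x)) - (int (the (g x)) - int (the (g v)))) mod int k"
    by (rule mod_diff_cong[OF _ shift_pattern_diff_mod[OF pat \<open>x \<in> e\<close>]])
      (simp add: \<open>f x = g x\<close>)
  then have v: "the (f v) = the (g v)"
    using val[OF \<open>v \<in> e\<close>] by (intro mod_eq_imp_eq_in_interval) auto
  have eq: "the (f y) = the (g y)" if "y \<in> e" for y
  proof -
    \<comment> \<open>Conversely, the value at \<open>v\<close> and the pattern together determine
      every other value.\<close>
    have "(int (the (f y)) - int (the (f v)) + int (the (f v))) mod int k =
          (int (the (g y)) - int (the (g v)) + int (the (g v))) mod int k"
      using shift_pattern_diff_mod[OF pat that] v by (intro mod_add_cong) auto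
    then show ?thesis
      using val[OF that] by (intro mod_eq_imp_eq_in_interval) auto
  qed
  show ?thesis
  proof
    fix y
    show "f y = g y"
      using eq[of y] dom by (cases "y \<in> e") (auto simp: domIff intro: option.expand)
  qed
qed

text \<open>This is the start of the induction over the edges. Partial maps with domain
  \<open>X\<close> are translated into extensional functions, which \<open>card_PiE\<close>
  counts.\<close>

lemma card_cover_colorings_empty:
  assumes "finite X"
  shows "card (cover_colorings k X {}) = k ^ card X"
proof -
  have "bij_betw (\<lambda>f. \<lambda>x\<in>X. the (f x)) (cover_colorings k X {}) (X \<rightarrow>\<^sub>E {1..k})"
  proof (rule bij_betw_byWitness[where f' = "\<lambda>g x. if x \<in> X then Some (g x) else None"])
    show "\<forall>f\<in>cover_colorings k X {}.
        (\<lambda>x. if x \<in> X then Some ((\<lambda>x\<in>X. the (f x)) x) else None) = f"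
      by (auto simp: cover_colorings_def fun_eq_iff dom_def)
    show "\<forall>g\<in>X \<rightarrow>\<^sub>E {1..k}. (\<lambda>x\<in>X. the (if x \<in> X then Some (g x) else None)) = g"
    proof
      fix g assume "g \<in> X \<rightarrow>\<^sub>E {1..k}"
      moreover have "(\<lambda>x\<in>X. the (if x \<in> X then Some (g x) else None)) = restrict g X"
        by (rule restrict_ext) simp
      ultimately show "(\<lambda>x\<in>X. the (if x \<in> X then Some (g x) else None)) = g"
        by (simp only: PiE_restrict)
    qed
    show "(\<lambda>f. \<lambda>x\<in>X. the (f x)) ` cover_colorings k X {} \<subseteq> X \<rightarrow>\<^sub>E {1..k}"
      by (intro image_subsetI restrict_PiE_iff[THEN iffD2] ballI the_in_if_ran_subset)
        (simp_all add: cover_colorings_def)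
    show "(\<lambda>g x. if x \<in> X then Some (g x) else None) ` (X \<rightarrow>\<^sub>E {1..k})
        \<subseteq> cover_colorings k X {}"
      by (auto simp: cover_colorings_def dom_def ran_def PiE_iff split: if_splits)
  qed
  then show ?thesis
    using assms by (simp add: bij_betw_same_card card_PiE)
qed

text \<open>The induction step: forbidding the whole class of a most popular pattern leaves at most
  the share \<open>1 - 1 / k ^ (card e - 1)\<close> of the colorings. The inequality is multiplied
  out so that it stays within the natural numbers.\<close>

lemma extend_cover_by_edge:
  assumes cover: "fold_cover k X E F"
    and X: "finite X" "e \<subseteq> X" and e: "card e \<ge> 1" "e \<notin> E" and k: "k \<ge> 1"
  shows "\<exists>F'. fold_cover k X (insert e E) F' \<and>
    k ^ (card e - 1) * card (cover_colorings k X F')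
      \<le> (k ^ (card e - 1) - 1) * card (cover_colorings k X F)"
proof -
  let ?K = "k ^ (card e - 1)" and ?C = "cover_colorings k X F"
  have fin_e: "finite e"
    using X by (rule rev_finite_subset)
  obtain v where v: "v \<in> e"
    using e(1) by fastforce
  define P where "P = (e - {v}) \<rightarrow>\<^sub>E {0..<int k}"
  have "finite P" "P \<noteq> {}" and card_P: "card P = ?K"
    using fin_e v k by (auto simp: P_def finite_PiE PiE_eq_empty_iff card_PiE)
  have fin_C: "finite ?C"
    using X(1) by (rule finite_cover_colorings)
  \<comment> \<open>The pattern \<open>s\<close> is shared by at least the average number of
    surviving colorings, taken over the \<open>?K\<close> patterns in \<open>P\<close>.\<close>
  obtain s where s: "card ?C \<le> ?K * card {f \<in> ?C. shift_pattern k e v f = s}"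
  proof -
    have "shift_pattern k e v \<in> ?C \<rightarrow> P"
      unfolding P_def by (intro Pi_I shift_pattern_in_PiE k)
    then obtain s where "card ?C \<le> card (shift_pattern k e v -` {s} \<inter> ?C) * card P"
      using pigeonhole_card fin_C \<open>finite P\<close> \<open>P \<noteq> {}\<close> by blast
    moreover have "shift_pattern k e v -` {s} \<inter> ?C = {f \<in> ?C. shift_pattern k e v f = s}"
      by auto
    ultimately show ?thesis
      using that[of s] card_P by (simp add: mult.commute)
  qed
  define G where
    "G = {\<phi>. dom \<phi> = e \<and> ran \<phi> \<subseteq> {1..k} \<and> shift_pattern k e v \<phi> = s}"
  have "Map.graph \<phi> \<inter> Map.graph \<psi> = {}" if "\<phi> \<in> G" "\<psi> \<in> G" "\<phi> \<noteq> \<psi>" for \<phi> \<psi>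
  proof (rule ccontr)
    assume "Map.graph \<phi> \<inter> Map.graph \<psi> \<noteq> {}"
    then obtain x y where "\<phi> x = Some y" "\<psi> x = Some y"
      by (auto simp: Map.graph_def)
    with that v show False
      using eq_if_shift_pattern_eq[of k e v \<phi> \<psi> x] by (auto simp: G_def)
  qed
  moreover have "dom \<phi> = e" "ran \<phi> \<subseteq> {1..k}" if "\<phi> \<in> G" for \<phi>
    using that by (simp_all add: G_def)
  \<comment> \<open>Since \<open>e\<close> is a new edge, no map of \<open>F\<close> shares its
    domain with a map of \<open>G\<close>, so no disjointness has to be checked between the two
    sets.\<close>
  moreover have "dom \<phi> \<noteq> e" if "\<phi> \<in> F" for \<phi>
    using that cover e(2) by (auto simp: fold_cover_def)
  ultimately have new_cover: "fold_cover k X (insert e E) (F \<union> G)"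
    using cover X(2) unfolding fold_cover_def by (simp add: ball_Un) metis
  \<comment> \<open>The pattern of a coloring depends only on its values on \<open>e\<close>. A
    coloring with pattern \<open>s\<close> therefore restricts to a member of \<open>G\<close> and
    is forbidden.\<close>
  have "cover_colorings k X (F \<union> G) \<subseteq> ?C - {f \<in> ?C. shift_pattern k e v f = s}"
  proof
    fix f assume f: "f \<in> cover_colorings k X (F \<union> G)"
    have "shift_pattern k e v f \<noteq> s"
    proof
      assume "shift_pattern k e v f = s"
      moreover have "shift_pattern k e v (f |` e) = shift_pattern k e v f"
        using v by (intro shift_pattern_cong) auto
      moreover have "dom (f |` e) = e" "ran (f |` e) \<subseteq> {1..k}"
        using f X(2) by (auto simp: cover_colorings_def ran_def restrict_map_def split: if_splits)
      ultimately have "f |` e \<in> G"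
        by (simp add: G_def)
      moreover have "f |` e \<subseteq>\<^sub>m f"
        by (auto simp: map_le_def)
      ultimately show False
        using f by (auto simp: cover_colorings_def)
    qed
    with f show "f \<in> ?C - {f \<in> ?C. shift_pattern k e v f = s}"
      by (auto simp: cover_colorings_def)
  qed
  then have "card (cover_colorings k X (F \<union> G))
      \<le> card ?C - card {f \<in> ?C. shift_pattern k e v f = s}"
    using card_mono[OF finite_Diff[OF fin_C]]
    by (subst card_Diff_subset[symmetric]) (auto intro: finite_subset[OF _ fin_C])
  then have "?K * card (cover_colorings k X (F \<union> G))
      \<le> ?K * card ?C - ?K * card {f \<in> ?C. shift_pattern k e v f = s}"
    by (simp only: mult_le_mono2 flip: diff_mult_distrib2)
  \<comment> \<open>By the choice of \<open>s\<close>, the subtracted term is at least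
    \<open>card ?C\<close>.\<close>
  also have "\<dots> \<le> (?K - 1) * card ?C"
    using s by (simp add: diff_mult_distrib)
  finally show ?thesis
    using new_cover by blast
qed

text \<open>Each new edge is handled relative to the colorings that survive the cover built so far,
  so the factors for the single edges multiply.\<close>

lemma exists_cover_few_colorings:
  assumes "finite E" "finite X" "k \<ge> 1" "r \<ge> 1" "\<And>e. e \<in> E \<Longrightarrow> e \<subseteq> X \<and> card e = r"
  shows "\<exists>F. fold_cover k X E F \<and>
    (k ^ (r - 1)) ^ card E * card (cover_colorings k X F)
      \<le> (k ^ (r - 1) - 1) ^ card E * k ^ card X"
  using assms(1,5)
proof (induction E rule: finite_induct)
  case empty
  have "fold_cover k X {} {}"
    by (simp add: fold_cover_def)
  then show ?case
    using card_cover_colorings_empty[OF assms(2), of k] by (intro exI[of _ "{}"]) simp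
next
  case (insert e E)
  let ?K = "k ^ (r - 1)"
  obtain F where F: "fold_cover k X E F"
    "?K ^ card E * card (cover_colorings k X F) \<le> (?K - 1) ^ card E * k ^ card X"
    using insert by auto
  obtain F' where F': "fold_cover k X (insert e E) F'"
    "?K * card (cover_colorings k X F') \<le> (?K - 1) * card (cover_colorings k X F)"
    using extend_cover_by_edge[OF F(1) assms(2), of e] insert assms by auto
  have "?K ^ card (insert e E) * card (cover_colorings k X F')
      = ?K ^ card E * (?K * card (cover_colorings k X F'))"
    using insert.hyps by simp
  also have "\<dots> \<le> ?K ^ card E * ((?K - 1) * card (cover_colorings k X F))"
    using F'(2) by (rule mult_le_mono2)
  also have "\<dots> = (?K - 1) * (?K ^ card E * card (cover_colorings k X F))"
    by simp
  also have "\<dots> \<le> (?K - 1) * ((?K - 1) ^ card E * k ^ card X)"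
    using F(2) by (rule mult_le_mono2)
  also have "\<dots> = (?K - 1) ^ card (insert e E) * k ^ card X"
    using insert.hyps by simp
  finally show ?case
    using F'(1) by blast
qed

theorem proposition1:
  fixes X :: "'a set" and E :: "'a set set" and r n k :: nat
  assumes "r \<ge> 2"
    and "simple_hypergraph X E"
    and "uniform_hypergraph r X E"
    and "card X = n" and "n \<ge> 1"
    and "k \<ge> 1"
  shows "real (dp_color_function X E k)
           \<le> real k ^ n * (real k ^ (r - 1) - 1) ^ card E / real k ^ ((r - 1) * card E)"
proof -
  have X: "finite X" "E \<subseteq> Pow X" and r: "\<And>e. e \<in> E \<Longrightarrow> card e = r"
    using assms(3) by (auto simp: uniform_hypergraph_def hypergraph_def)
  have "finite E"
    using X by (meson finite_Pow_iff finite_subset)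
  then obtain F where F: "fold_cover k X E F"
    "(k ^ (r - 1)) ^ card E * card (cover_colorings k X F)
      \<le> (k ^ (r - 1) - 1) ^ card E * k ^ card X"
    using exists_cover_few_colorings[of E X k r] X r assms(1,6) by auto
  have "(k ^ (r - 1)) ^ card E * dp_color_function X E k
      \<le> (k ^ (r - 1) - 1) ^ card E * k ^ n"
    \<comment> \<open>The DP color function is a minimum over all covers, so the one cover
      \<open>F\<close> bounds it.\<close>
    using F(2) mult_le_mono2[OF dp_color_function_le[OF F(1)]] assms(4) le_trans by blast
  then have "real ((k ^ (r - 1)) ^ card E * dp_color_function X E k)
      \<le> real ((k ^ (r - 1) - 1) ^ card E * k ^ n)"
    by (simp only: of_nat_le_iff)
  then have "real k ^ ((r - 1) * card E) * real (dp_color_function X E k)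
      \<le> (real k ^ (r - 1) - 1) ^ card E * real k ^ n"
    \<comment> \<open>As \<open>k\<close> is positive, \<open>k ^ (r - 1)\<close> is at least 1, and
      the truncated subtraction agrees with the real one.\<close>
    using assms(6) by (simp add: of_nat_diff power_mult)
  then show ?thesis
    using assms(6) by (simp add: pos_le_divide_eq mult.commute)
qed

end
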